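(* Let $A, B \in \mathbb{C}^{n\times n}$ be Hermitian positive semi-definite. If $\operatorname{rank}(B) = 1 = \operatorname{intdim}(B)$, then $$1 \le \operatorname{intdim}(A+B) \le \operatorname{intdim}(A) + 1.$$
   Context: For a non-zero Hermitian positive semi-definite matrix $A\in\mathbb{C}^{n\times n}$, the intrinsic dimension is $\operatorname{intdim}(A) = \operatorname{trace}(A)/\|A\|_2$, where $\|A\|_2$ is the operator two-norm (largest singular value). For the zero matrix, $\operatorname{intdim}(0)=0$. (Every rank-one Hermitian positive semi-definite matrix has intrinsic dimension 1.) *)

theory Defs
  imports "HOL-Analysis.Analysis"
begin

definition conj_transpose :: "complex ^ 'n ^ 'm \<Rightarrow> complex ^ 'm ^ 'n" where
  "conj_transpose A = map_matrix cnj (transpose A)"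

definition hermitian :: "complex ^ 'n ^ 'n \<Rightarrow> bool" where
  "hermitian A \<longleftrightarrow> conj_transpose A = A"

text \<open>
  The inner product of the library on complex vectors is the real one, so the quadratic form
  \<open>x\<^sup>* A x\<close> is spelled out. It is automatically real for Hermitian \<open>A\<close>; \<open>Re\<close> only
  changes its type.
\<close>

definition hermitian_psd :: "complex ^ 'n ^ 'n \<Rightarrow> bool" where
  "hermitian_psd A \<longleftrightarrow>
     hermitian A \<and> (\<forall>x. 0 \<le> Re (\<Sum>i\<in>UNIV. cnj (x $ i) * (A *v x) $ i))"

text \<open>
  The norm on \<open>complex ^ 'n\<close> is the Euclidean one, so \<open>onorm\<close> is the operator two-norm.
\<close>

definition two_norm :: "complex ^ 'n ^ 'm \<Rightarrow> real" where
  "two_norm A = onorm (\<lambda>x. A *v x)"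

text \<open>
  Intended for Hermitian positive semi-definite arguments, whose trace is real.
\<close>

definition intdim :: "complex ^ 'n ^ 'n \<Rightarrow> real" where
  "intdim A = (if A = 0 then 0 else Re (trace A) / two_norm A)"

end

theory Submission
  imports Defs
begin

text \<open>
  The form \<open>Re (y\<^sup>* A x)\<close> is the real inner product of \<open>y\<close> and \<open>A x\<close>, so
  a positive semi-definite \<open>A\<close> obeys the Cauchy-Schwarz inequality
  \<open>(y \<bullet> A x)\<^sup>2 \<le> (x \<bullet> A x) (y \<bullet> A y)\<close>. Taking \<open>y = A x\<close> shows that the
  operator norm is monotone on positive semi-definite matrices; taking for \<open>y\<close> the
  coordinate vectors of \<open>A x\<close> and summing gives
  \<open>\<parallel>A x\<parallel>\<^sup>2 \<le> tr A (x \<bullet> A x)\<close>, hence \<open>\<parallel>A\<parallel> \<le> tr A\<close>, which is the lower bound.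
  For the upper bound, split \<open>tr (A + B) = tr A + tr B\<close> and use
  \<open>\<parallel>A + B\<parallel> \<ge> \<parallel>A\<parallel>\<close> for the first summand and \<open>\<parallel>A + B\<parallel> \<ge> \<parallel>B\<parallel> = tr B\<close> for the second.
\<close>

text \<open>The form at \<open>x + t *\<^sub>R y\<close> is a polynomial of degree at most two in
  the real \<open>t\<close>, nonnegative everywhere. As the form is only semi-definite, its leading
  coefficient \<open>c\<close> may vanish.\<close>

lemma psd_form_Cauchy_Schwarz:
  fixes f :: "'a::real_inner \<Rightarrow> 'a"
  assumes "linear f" and sym: "\<And>x y. x \<bullet> f y = f x \<bullet> y" and psd: "\<And>x. 0 \<le> x \<bullet> f x"
  shows "(y \<bullet> f x)\<^sup>2 \<le> (x \<bullet> f x) * (y \<bullet> f y)"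
proof -
  interpret linear f by fact
  define a b c where "a = x \<bullet> f x" and "b = y \<bullet> f x" and "c = y \<bullet> f y"
  have b': "x \<bullet> f y = b"
    unfolding b_def by (metis sym inner_commute)
  have q: "0 \<le> a + 2 * t * b + t\<^sup>2 * c" for t
    using psd[of "x + t *\<^sub>R y"] b'
    by (simp add: add scaleR inner_add_left inner_add_right a_def b_def c_def
        power2_eq_square algebra_simps)
  have "b\<^sup>2 \<le> a * c"
  proof (cases "c = 0")
    case True
    have "b = 0"
    proof (rule ccontr)
      assume "b \<noteq> 0"
      then show False
        \<comment> \<open>With \<open>c = 0\<close> the polynomial is affine, and this
          \<open>t\<close> gives it the value -1.\<close>
        using q[of "- (a + 1) / (2 * b)"] True by (simp add: field_simps)
    qed
    with True show ?thesis by simp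
  next
    case False
    then have "c > 0"
      using psd[of y] by (simp add: c_def)
    then show ?thesis
      \<comment> \<open>The minimiser of the quadratic, where its value is
        \<open>a - b\<^sup>2 / c\<close>.\<close>
      using q[of "- b / c"] by (simp add: field_simps power2_eq_square)
  qed
  then show ?thesis
    by (simp add: a_def b_def c_def)
qed

lemma linear_complex_matrix_vector_mult: "linear ((*v) (A :: complex ^ 'n ^ 'm))"
  by (rule linearI, rule matrix_vector_right_distrib)
    (simp add: vec_eq_iff matrix_vector_mult_def scaleR_sum_right)

lemma norm_mult_le_two_norm: "norm (A *v x) \<le> two_norm A * norm x"
  unfolding two_norm_def
  using linear_complex_matrix_vector_mult by (intro onorm) (simp add: linear_conv_bounded_linear)

lemma hermitian_cnj_entry:
  assumes "hermitian A"
  shows "cnj (A $ i $ j) = A $ j $ i"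
proof -
  have "conj_transpose A $ j $ i = cnj (A $ i $ j)"
    by (simp add: conj_transpose_def map_matrix_def transpose_def)
  with assms show ?thesis
    by (simp add: hermitian_def)
qed

text \<open>Exchanging the two sums and using \<open>cnj (A $ i $ j) = A $ j $ i\<close> moves the
  matrix to the other argument. This supplies the symmetry for the real Cauchy-Schwarz
  inequality.\<close>

lemma hermitian_inner_swap:
  fixes A :: "complex ^ 'n ^ 'n"
  assumes "hermitian A"
  shows "x \<bullet> (A *v y) = (A *v x) \<bullet> y"
proof -
  have "x \<bullet> (A *v y) = Re (\<Sum>i\<in>UNIV. \<Sum>j\<in>UNIV. cnj (x $ i) * (A $ i $ j * y $ j))"
    by (simp add: inner_vec_def inner_complex_def matrix_vector_mult_def
        sum_distrib_left[symmetric])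
  also have "\<dots> = Re (\<Sum>j\<in>UNIV. \<Sum>i\<in>UNIV. cnj (x $ i) * (A $ i $ j * y $ j))"
    by (subst sum.swap) simp
  also have "\<dots> = Re (\<Sum>j\<in>UNIV. cnj (\<Sum>i\<in>UNIV. A $ j $ i * x $ i) * y $ j)"
    by (simp add: hermitian_cnj_entry[OF assms] cnj_sum sum_distrib_left sum_distrib_right mult_ac
        del: Re_sum)
  also have "\<dots> = (A *v x) \<bullet> y"
    by (simp add: inner_vec_def inner_complex_def matrix_vector_mult_def del: cnj_sum Im_sum)
  finally show ?thesis .
qed

lemma hermitian_psd_inner_nonneg: "hermitian_psd A \<Longrightarrow> 0 \<le> x \<bullet> (A *v x)"
  by (simp add: hermitian_psd_def inner_vec_def inner_complex_def)

lemma hermitian_psd_Cauchy_Schwarz: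
  fixes A :: "complex ^ 'n ^ 'n"
  assumes "hermitian_psd A"
  shows "(y \<bullet> (A *v x))\<^sup>2 \<le> (x \<bullet> (A *v x)) * (y \<bullet> (A *v y))"
  using assms
  by (intro psd_form_Cauchy_Schwarz linear_complex_matrix_vector_mult hermitian_inner_swap
      hermitian_psd_inner_nonneg) (auto simp: hermitian_psd_def)

lemma hermitian_psd_add:
  assumes "hermitian_psd A" "hermitian_psd B"
  shows "hermitian_psd (A + B)"
proof -
  have "hermitian (A + B)"
    using assms unfolding hermitian_psd_def hermitian_def conj_transpose_def
    by (simp add: vec_eq_iff map_matrix_def transpose_def)
  with assms show ?thesis
    unfolding hermitian_psd_def
    by (simp add: matrix_vector_mult_add_rdistrib distrib_left sum.distrib)
qed

lemma two_norm_mono: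
  fixes A M :: "complex ^ 'n ^ 'n"
  assumes A: "hermitian_psd A" and le: "\<And>x. x \<bullet> (A *v x) \<le> x \<bullet> (M *v x)"
  shows "two_norm A \<le> two_norm M"
proof -
  have form: "x \<bullet> (A *v x) \<le> two_norm M * (norm x)\<^sup>2" for x
  proof -
    have "x \<bullet> (A *v x) \<le> norm x * norm (M *v x)"
      using le norm_cauchy_schwarz order_trans by blast
    also have "\<dots> \<le> norm x * (two_norm M * norm x)"
      by (intro mult_left_mono norm_mult_le_two_norm) simp
    finally show ?thesis by (simp add: power2_eq_square mult_ac)
  qed
  have "norm (A *v x) \<le> two_norm M * norm x" for x
  proof (cases "A *v x = 0")
    case True
    have "0 \<le> two_norm M * norm x"
      using norm_ge_zero norm_mult_le_two_norm order_trans by blast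
    with True show ?thesis by simp
  next
    case False
    let ?u = "A *v x"
    \<comment> \<open>Cauchy-Schwarz with \<open>y = ?u\<close>, followed by \<open>form\<close> at
      both \<open>x\<close> and \<open>?u\<close>, leaves a common factor
      \<open>(norm ?u)\<^sup>2\<close> to cancel.\<close>
    have "(norm ?u)\<^sup>2 * (norm ?u)\<^sup>2 = (?u \<bullet> (A *v x))\<^sup>2"
      by (simp add: power2_norm_eq_inner power2_eq_square[of "?u \<bullet> ?u"])
    also have "\<dots> \<le> (x \<bullet> (A *v x)) * (?u \<bullet> (A *v ?u))"
      by (rule hermitian_psd_Cauchy_Schwarz[OF A])
    also have "\<dots> \<le> (two_norm M * (norm x)\<^sup>2) * (two_norm M * (norm ?u)\<^sup>2)"
      using hermitian_psd_inner_nonneg[OF A] form order_trans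
      by (intro mult_mono form) blast+
    also have "\<dots> = (two_norm M * norm x)\<^sup>2 * (norm ?u)\<^sup>2"
      by (simp add: power2_eq_square)
    finally have "(norm ?u)\<^sup>2 \<le> (two_norm M * norm x)\<^sup>2"
      using False by (metis mult_right_le_imp_le zero_less_norm_iff zero_less_power)
    moreover have "0 \<le> two_norm M * norm x"
      using norm_ge_zero norm_mult_le_two_norm order_trans by blast
    ultimately show ?thesis
      by (rule power2_le_imp_le)
  qed
  then show ?thesis
    unfolding two_norm_def[of A] by (rule onorm_le)
qed

text \<open>The scalar \<open>c\<close> is kept general because the real inner product with
  \<open>axis i 1\<close> sees only the real part of an entry; choosing \<open>c\<close> as the
  entry itself recovers its full squared modulus.\<close>

lemma inner_axis_mult_axis:
  fixes A :: "complex ^ 'n ^ 'n"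
  shows "axis i c \<bullet> (A *v axis i c) = (cmod c)\<^sup>2 * Re (A $ i $ i)"
proof -
  have "(A *v axis i c) $ i = A $ i $ i * c"
    by (simp add: matrix_vector_mult_def axis_def if_distrib cong: if_cong)
  then have "axis i c \<bullet> (A *v axis i c) = c \<bullet> (A $ i $ i * c)"
    by (simp add: inner_axis')
  then show ?thesis
    by (simp add: inner_complex_def cmod_power2) (simp add: power2_eq_square algebra_simps)
qed

lemma hermitian_psd_diag_nonneg:
  assumes "hermitian_psd A"
  shows "0 \<le> Re (A $ i $ i)"
  using hermitian_psd_inner_nonneg[OF assms, of "axis i 1"] inner_axis_mult_axis[of i 1 A]
  by simp

lemma hermitian_psd_trace_nonneg: "hermitian_psd A \<Longrightarrow> 0 \<le> Re (trace A)"
  by (simp add: trace_def sum_nonneg hermitian_psd_diag_nonneg)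

lemma two_norm_le_trace:
  fixes A :: "complex ^ 'n ^ 'n"
  assumes A: "hermitian_psd A"
  shows "two_norm A \<le> Re (trace A)"
  unfolding two_norm_def
proof (rule onorm_le)
  fix x
  let ?u = "A *v x"
  have entry: "(cmod (?u $ i))\<^sup>2 \<le> Re (A $ i $ i) * (x \<bullet> ?u)" for i
  proof (cases "?u $ i = 0")
    case True
    then show ?thesis
      using hermitian_psd_diag_nonneg[OF A] hermitian_psd_inner_nonneg[OF A] by simp
  next
    case False
    have "axis i (?u $ i) \<bullet> ?u = (cmod (?u $ i))\<^sup>2"
      by (simp add: inner_axis' power2_norm_eq_inner)
    then have "(cmod (?u $ i))\<^sup>2 * (cmod (?u $ i))\<^sup>2
        \<le> (cmod (?u $ i))\<^sup>2 * (Re (A $ i $ i) * (x \<bullet> ?u))"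
      using hermitian_psd_Cauchy_Schwarz[OF A, of "axis i (?u $ i)" x]
      by (simp add: inner_axis_mult_axis power2_eq_square mult_ac)
    with False show ?thesis
      by (metis mult_left_le_imp_le zero_less_norm_iff zero_less_power)
  qed
  have "norm ?u * norm ?u = (\<Sum>i\<in>UNIV. (cmod (?u $ i))\<^sup>2)"
    by (simp add: norm_vec_def L2_set_def sum_nonneg)
  also have "\<dots> \<le> (\<Sum>i\<in>UNIV. Re (A $ i $ i) * (x \<bullet> ?u))"
    by (intro sum_mono entry)
  also have "\<dots> = Re (trace A) * (x \<bullet> ?u)"
    by (simp add: trace_def sum_distrib_right)
  also have "\<dots> \<le> Re (trace A) * (norm x * norm ?u)"
    by (intro mult_left_mono norm_cauchy_schwarz hermitian_psd_trace_nonneg A)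
  \<comment> \<open>The ordinary Cauchy-Schwarz bound on \<open>x \<bullet> ?u\<close> brings in one
    more \<open>norm ?u\<close>, so one factor cancels.\<close>
  finally have "norm ?u * norm ?u \<le> (Re (trace A) * norm x) * norm ?u"
    by (simp add: mult_ac)
  then show "norm ?u \<le> Re (trace A) * norm x"
    using hermitian_psd_trace_nonneg[OF A] by (cases "?u = 0") simp_all
qed

lemma two_norm_pos:
  assumes "A \<noteq> 0"
  shows "0 < two_norm A"
proof (rule ccontr)
  assume "\<not> 0 < two_norm A"
  then have "norm (A *v x) \<le> 0" for x
    using norm_mult_le_two_norm[of A x] by (meson mult_nonpos_nonneg norm_ge_zero not_less order_trans)
  then have "A = 0"
    by (simp add: matrix_eq)
  with assms show False ..
qed

theorem theorem3p4:
  fixes A B :: "complex ^ 'n ^ 'n"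
  assumes "hermitian_psd A" and "hermitian_psd B"
    and "rank B = 1" and "intdim B = 1"
  shows "1 \<le> intdim (A + B) \<and> intdim (A + B) \<le> intdim A + 1"
proof
  note A = assms(1) and B = assms(2)
  \<comment> \<open>The zero matrix has \<open>intdim\<close> 0 by convention, not 1.\<close>
  have "B \<noteq> 0"
    using assms(4) by (auto simp: intdim_def)
  then have posB: "0 < two_norm B"
    by (rule two_norm_pos)
  then have trB: "Re (trace B) = two_norm B"
    using assms(4) \<open>B \<noteq> 0\<close> by (simp add: intdim_def field_simps)
  have leA: "two_norm A \<le> two_norm (A + B)"
    using hermitian_psd_inner_nonneg[OF B]
    by (intro two_norm_mono A) (simp add: matrix_vector_mult_add_rdistrib inner_add_right)
  have leB: "two_norm B \<le> two_norm (A + B)"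
    using hermitian_psd_inner_nonneg[OF A]
    by (intro two_norm_mono B) (simp add: matrix_vector_mult_add_rdistrib inner_add_right)
  with posB have pos: "0 < two_norm (A + B)"
    by linarith
  have trAB: "Re (trace (A + B)) = Re (trace A) + two_norm B"
    by (simp add: trace_add trB)
  have "A + B \<noteq> 0"
    using pos by (auto simp: two_norm_def onorm_zero)
  then have eq: "intdim (A + B) = Re (trace A) / two_norm (A + B) + two_norm B / two_norm (A + B)"
    by (simp add: intdim_def trAB add_divide_distrib)
  show "1 \<le> intdim (A + B)"
    using two_norm_le_trace[OF hermitian_psd_add[OF A B]] pos \<open>A + B \<noteq> 0\<close>
    by (simp add: intdim_def)
  \<comment> \<open>For \<open>A = 0\<close> both sides are 0; otherwise enlarging the positive
    denominator shrinks the quotient, as the trace is nonnegative.\<close>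
  have "Re (trace A) / two_norm (A + B) \<le> intdim A"
  proof (cases "A = 0")
    case True
    then show ?thesis by (simp add: intdim_def trace_def)
  next
    case False
    then show ?thesis
      using hermitian_psd_trace_nonneg[OF A] two_norm_pos[OF False] leA
      by (simp add: intdim_def frac_le)
  qed
  moreover have "two_norm B / two_norm (A + B) \<le> 1"
    using leB pos by simp
  ultimately show "intdim (A + B) \<le> intdim A + 1"
    unfolding eq by linarith
qed

end
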